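(* There exists an absolute constant $c_H>0$ such that for all sufficiently large $n$ that is a multiple of $4$, $$H(n)\le 2^{\frac{(1-c_H)n^2}{2}},$$ where $H(n)$ denotes the number of Hadamard matrices of order $n$.
   Context: A Hadamard matrix of order $n$ is an $n\times n$ matrix $H$ with all entries in $\{-1,+1\}$ whose rows are pairwise orthogonal, i.e. $HH^{T}=nI_n$. $H(n)$ counts all such matrices as distinct matrices (no identification up to equivalence). *)

theory Defs
  imports Complex_Main "HOL-Library.FuncSet" "Jordan_Normal_Form.Matrix"
begin

definition hadamard_matrices :: "nat \<Rightarrow> real mat set" where
  "hadamard_matrices n =
     {H \<in> carrier_mat n n.
        elements_mat H \<subseteq> {-1, 1} \<and> H * transpose_mat H = real n \<cdot>\<^sub>m 1\<^sub>m n}"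

definition hadamard_count :: "nat \<Rightarrow> nat" where
  "hadamard_count n = card (hadamard_matrices n)"

(* Since card is 0 on infinite sets, this lemma is needed for hadamard_count to be a genuine count. *)
lemma finite_hadamard_matrices: "finite (hadamard_matrices n)"
proof -
  let ?F = "({..<n} \<times> {..<n}) \<rightarrow>\<^sub>E {-1, 1 :: real}"
  have "hadamard_matrices n \<subseteq> mat n n ` ?F"
  proof
    fix H assume H: "H \<in> hadamard_matrices n"
    then have dim: "H \<in> carrier_mat n n" and el: "elements_mat H \<subseteq> {-1, 1}"
      by (auto simp: hadamard_matrices_def)
    let ?f = "restrict (\<lambda>p. H $$ p) ({..<n} \<times> {..<n})"
    have "H $$ (i, j) \<in> {-1, 1}" if "i < n" "j < n" for i j
      using elements_matI[OF dim that refl] el by blast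
    then have "?f \<in> ?F"
      by (auto simp: restrict_PiE_iff simp del: insert_iff)
    moreover have "H = mat n n ?f"
      using dim by (intro eq_matI) auto
    ultimately show "H \<in> mat n n ` ?F" by blast
  qed
  moreover have "finite ?F" by (intro finite_PiE) auto
  ultimately show ?thesis by (meson finite_imageI finite_subset)
qed

end

theory Submission
  imports Defs "HOL-Analysis.Convex"
begin

text \<open>Build the matrix row by row. A sign vector orthogonal to the first \<open>k\<close> rows is determined by
  its entries outside a basis of the column space, so there are at most \<open>2 ^ (n - k)\<close> choices for the
  next row; multiplied over all \<open>k\<close> this only gives the exponent \<open>n (n + 1) / 2\<close>. Because the
  rows are orthogonal, any set of at least \<open>3 n / 4\<close> columns has rank at least \<open>3 k / 4\<close>, so for
  \<open>12 k \<le> n\<close> one can greedily pick four disjoint independent sets of about \<open>3 k / 4\<close> columns each.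
  Two applications of Cauchy-Schwarz bound the number of solutions supported on these four sets by
  the number of solutions with four copies of one set, where each column must cancel separately,
  which happens for \<open>6\<close> of \<open>16\<close> sign patterns. This gives at most \<open>2 ^ n (3/8) ^ (3 k / 4)\<close> choices, which
  beats \<open>2 ^ (n - k)\<close> by a factor exponential in \<open>k\<close>.\<close>

section \<open>Inner products, independence and rank of column families\<close>

definition ip :: "nat \<Rightarrow> (nat \<Rightarrow> real) \<Rightarrow> (nat \<Rightarrow> real) \<Rightarrow> real" where
  "ip d x y = (\<Sum>p<d. x p * y p)"

text \<open>Independence is that of an indexed family, so equal vectors at two indices of
  \<open>B\<close> count as dependent. Only coordinates below \<open>d\<close> are tested.\<close>

definition indep :: "nat \<Rightarrow> ('j \<Rightarrow> nat \<Rightarrow> real) \<Rightarrow> 'j set \<Rightarrow> bool" where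
  "indep d a B \<longleftrightarrow>
     (\<forall>c. (\<forall>p<d. (\<Sum>j\<in>B. c j * a j p) = 0) \<longrightarrow> (\<forall>j\<in>B. c j = 0))"

definition orthonormal :: "nat \<Rightarrow> ('j \<Rightarrow> nat \<Rightarrow> real) \<Rightarrow> 'j set \<Rightarrow> bool" where
  "orthonormal d u B \<longleftrightarrow> (\<forall>b\<in>B. \<forall>b'\<in>B. ip d (u b) (u b') = (if b = b' then 1 else 0))"

lemma ip_cong:
  "(\<And>p. p < d \<Longrightarrow> x p = x' p) \<Longrightarrow> (\<And>p. p < d \<Longrightarrow> y p = y' p) \<Longrightarrow> ip d x y = ip d x' y'"
  unfolding ip_def by (intro sum.cong) auto

lemma ip_commute: "ip d x y = ip d y x"
  unfolding ip_def by (simp add: mult.commute)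

lemma ip_diff_left: "ip d (\<lambda>p. x p - y p) z = ip d x z - ip d y z"
  unfolding ip_def by (simp add: left_diff_distrib sum_subtractf)

lemma ip_scale_left: "ip d (\<lambda>p. s * x p) z = s * ip d x z"
  unfolding ip_def by (simp add: sum_distrib_left mult.assoc)

lemma ip_sum_left: "ip d (\<lambda>p. \<Sum>b\<in>B. c b * u b p) z = (\<Sum>b\<in>B. c b * ip d (u b) z)"
  unfolding ip_def sum_distrib_right sum_distrib_left
  by (subst sum.swap) (simp add: mult.assoc)

lemma ip_self_pos:
  assumes "p < d" "x p \<noteq> 0"
  shows "ip d x x > 0"
  unfolding ip_def
  by (rule sum_pos2[of _ p]) (use assms in \<open>auto simp: zero_less_mult_iff\<close>)

lemma indep_subset:
  assumes "indep d a B" "C \<subseteq> B" "finite B"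
  shows "indep d a C"
  unfolding indep_def
proof (intro allI impI)
  fix c assume c: "\<forall>p<d. (\<Sum>j\<in>C. c j * a j p) = 0"
  let ?c = "\<lambda>j. if j \<in> C then c j else 0"
  have "(\<Sum>j\<in>B. ?c j * a j p) = (\<Sum>j\<in>C. c j * a j p)" for p
    using assms by (intro sum.mono_neutral_cong_right) auto
  with c assms(1) have "\<forall>j\<in>B. ?c j = 0"
    unfolding indep_def by presburger
  with assms(2) show "\<forall>j\<in>C. c j = 0"
    by (metis subsetD)
qed

text \<open>Pairing a vanishing combination with \<open>w\<close> kills every term except that of
  \<open>j\<close>, so the coefficient of \<open>j\<close> is zero and independence of
  \<open>B\<close> handles the others.\<close>

lemma indep_insert:
  assumes "indep d a B" "finite B" "j \<notin> B"
    and "\<And>b. b \<in> B \<Longrightarrow> ip d (a b) w = 0" "ip d (a j) w \<noteq> 0"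
  shows "indep d a (insert j B)"
  unfolding indep_def
proof (intro allI impI)
  fix c assume c: "\<forall>p<d. (\<Sum>i\<in>insert j B. c i * a i p) = 0"
  have "0 = ip d (\<lambda>p. \<Sum>i\<in>insert j B. c i * a i p) w"
    using c by (simp add: ip_def)
  also have "\<dots> = c j * ip d (a j) w"
    unfolding ip_sum_left using assms by simp
  finally have "c j = 0" using assms by simp
  with c assms have "\<forall>p<d. (\<Sum>i\<in>B. c i * a i p) = 0" by simp
  with assms(1) \<open>c j = 0\<close> show "\<forall>i\<in>insert j B. c i = 0"
    unfolding indep_def by blast
qed

text \<open>Gram-Schmidt by induction on \<open>S\<close>: a vector whose residual \<open>w\<close>
  vanishes is already spanned and is skipped; otherwise its index joins \<open>B\<close> and the
  normalised residual joins \<open>u\<close>. Thus \<open>B\<close> indexes both the chosen vectors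
  and the orthonormal family.\<close>

lemma gram_schmidt_selection:
  fixes a :: "'j \<Rightarrow> nat \<Rightarrow> real"
  assumes "finite S"
  shows "\<exists>B\<subseteq>S. \<exists>u. indep d a B \<and> orthonormal d u B \<and>
           (\<forall>j\<in>S. \<forall>p<d. a j p = (\<Sum>b\<in>B. ip d (a j) (u b) * u b p))"
  using assms
proof (induction S)
  case empty
  show ?case by (rule exI[of _ "{}"]) (auto simp: indep_def orthonormal_def)
next
  case (insert j S)
  then obtain B u where B: "B \<subseteq> S" "indep d a B" and u: "orthonormal d u B"
    and span: "\<And>i p. i \<in> S \<Longrightarrow> p < d \<Longrightarrow> a i p = (\<Sum>b\<in>B. ip d (a i) (u b) * u b p)"
    by blast
  have fin: "finite B" using B insert by (meson finite_subset)
  have jB: "j \<notin> B" using B insert by auto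
  define w where "w = (\<lambda>p. a j p - (\<Sum>b\<in>B. ip d (a j) (u b) * u b p))"
  have wu: "ip d w (u b) = 0" if "b \<in> B" for b
  proof -
    have "(\<Sum>b'\<in>B. ip d (a j) (u b') * ip d (u b') (u b))
        = (\<Sum>b'\<in>B. if b' = b then ip d (a j) (u b') else 0)"
      using u that by (intro sum.cong) (auto simp: orthonormal_def)
    then show ?thesis
      unfolding w_def ip_diff_left ip_sum_left using that fin by simp
  qed
  have ortho_w: "ip d (a i) w = 0" if "i \<in> S" for i
  proof -
    have "ip d (a i) w = ip d (\<lambda>p. \<Sum>b\<in>B. ip d (a i) (u b) * u b p) w"
      by (rule ip_cong) (use span[OF that] in auto)
    also have "\<dots> = 0"
      unfolding ip_sum_left using wu by (simp add: ip_commute[of d "u _" w])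
    finally show ?thesis .
  qed
  show ?case
  proof (cases "\<forall>p<d. w p = 0")
    case True
    have "\<forall>i\<in>insert j S. \<forall>p<d. a i p = (\<Sum>b\<in>B. ip d (a i) (u b) * u b p)"
      using True span by (auto simp: w_def)
    with B u show ?thesis by blast
  next
    case False
    then obtain p where "p < d" "w p \<noteq> 0" by blast
    then have pos: "ip d w w > 0" by (rule ip_self_pos)
    \<comment> \<open>\<open>a j\<close> and \<open>w\<close> differ by a projection onto the old
      \<open>u b\<close>, all of which are orthogonal to \<open>w\<close>.\<close>
    have ajw: "ip d (a j) w = ip d w w"
    proof -
      have "ip d w w = ip d (a j) w - (\<Sum>b\<in>B. ip d (a j) (u b) * ip d (u b) w)"
        by (subst (1) w_def) (simp only: ip_diff_left ip_sum_left)
      then show ?thesis using wu by (simp add: ip_commute[of d "u _" w])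
    qed
    define s where "s = 1 / sqrt (ip d w w)"
    have s2: "s * s * ip d w w = 1"
      using pos by (simp add: s_def)
    define u' where "u' = u(j := (\<lambda>p. s * w p))"
    have u'B: "u' b = u b" if "b \<in> B" for b using that jB by (auto simp: u'_def)
    have u'j: "u' j = (\<lambda>p. s * w p)" by (simp add: u'_def)
    have sc: "ip d x (u' j) = s * ip d x w" for x
      unfolding u'j by (subst ip_commute, subst ip_scale_left) (simp add: ip_commute)
    have "indep d a (insert j B)"
      by (rule indep_insert[of d a B j w]) (use B fin jB ortho_w ajw pos in auto)
    moreover have "orthonormal d u' (insert j B)"
      unfolding orthonormal_def
    proof (intro ballI)
      fix b b' assume bb: "b \<in> insert j B" "b' \<in> insert j B"
      have jj: "ip d (u' j) (u' j) = 1"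
        unfolding sc using s2 by (simp add: u'j ip_scale_left mult.assoc)
      have jb: "ip d (u' b) (u' j) = 0" "ip d (u' j) (u' b) = 0" if "b \<in> B" for b
        using wu[OF that] by (simp_all add: sc ip_commute[of d "u' j"] u'B[OF that] ip_commute[of d "u b"])
      show "ip d (u' b) (u' b') = (if b = b' then 1 else 0)"
        using bb jj jb u jB u'B unfolding orthonormal_def by (metis insertE)
    qed
    moreover have "a i p = (\<Sum>b\<in>insert j B. ip d (a i) (u' b) * u' b p)"
      if "i \<in> insert j S" "p < d" for i p
    proof -
      \<comment> \<open>The new term vanishes for old indices by \<open>ortho_w\<close>; for
        \<open>i = j\<close> it is exactly the residual \<open>w\<close>.\<close>
      have *: "(\<Sum>b\<in>insert j B. ip d (a i) (u' b) * u' b p)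
        = s * ip d (a i) w * (s * w p) + (\<Sum>b\<in>B. ip d (a i) (u b) * u b p)"
        using fin jB u'B fun_cong[OF u'j, of p] by (simp add: sc)
      show ?thesis
      proof (cases "i = j")
        case True
        have "s * ip d (a i) w * (s * w p) = w p"
          using s2 unfolding True ajw by (metis mult.assoc mult.commute mult_1)
        moreover have "a j p = w p + (\<Sum>b\<in>B. ip d (a j) (u b) * u b p)"
          by (simp add: w_def)
        ultimately show ?thesis unfolding * using True by simp
      next
        case False
        then show ?thesis unfolding * using span ortho_w that by simp
      qed
    qed
    ultimately show ?thesis
      using B by (intro exI[of _ "insert j B"]) auto
  qed
qed

text \<open>If the rows of a matrix with columns \<open>a j\<close> are orthogonal of squared norm \<open>N\<close>, its operator
  norm is \<open>sqrt N\<close>; comparing with the Frobenius norm of the columns in \<open>S\<close> bounds their rank.\<close>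

lemma exists_large_indep:
  fixes a :: "'j \<Rightarrow> nat \<Rightarrow> real"
  assumes J: "finite J" "S \<subseteq> J"
    and orth: "\<And>p q. p < d \<Longrightarrow> q < d \<Longrightarrow> (\<Sum>j\<in>J. a j p * a j q) = (if p = q then N else 0)"
  shows "\<exists>B\<subseteq>S. indep d a B \<and> (\<Sum>j\<in>S. ip d (a j) (a j)) \<le> real (card B) * N"
proof -
  have finS: "finite S" using J by (meson finite_subset)
  obtain B u where B: "B \<subseteq> S" "indep d a B" and u: "orthonormal d u B"
    and span: "\<And>j p. j \<in> S \<Longrightarrow> p < d \<Longrightarrow> a j p = (\<Sum>b\<in>B. ip d (a j) (u b) * u b p)"
    using gram_schmidt_selection[OF finS, of d a] by blast
  \<comment> \<open>Row orthogonality makes pairing with all the columns scale squared norms by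
    \<open>N\<close>; \<open>u b\<close> is a unit vector.\<close>
  have "(\<Sum>j\<in>J. (ip d (a j) (u b))\<^sup>2) = N" if "b \<in> B" for b
  proof -
    have "(\<Sum>j\<in>J. (ip d (a j) (u b))\<^sup>2)
        = (\<Sum>j\<in>J. \<Sum>p<d. \<Sum>q<d. (u b p * u b q) * (a j p * a j q))"
      unfolding ip_def power2_eq_square sum_product by (simp add: algebra_simps)
    also have "\<dots> = (\<Sum>p<d. \<Sum>q<d. (u b p * u b q) * (\<Sum>j\<in>J. a j p * a j q))"
      unfolding sum_distrib_left by (subst sum.swap, subst (2) sum.swap) (rule refl)
    also have "\<dots> = (\<Sum>p<d. \<Sum>q<d. if q = p then u b p * u b q * N else 0)"
      using orth by (intro sum.cong) auto
    also have "\<dots> = N * ip d (u b) (u b)"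
      by (simp add: ip_def sum_distrib_left algebra_simps)
    finally show ?thesis using u that by (simp add: orthonormal_def)
  qed
  note parseval = this
  have "(\<Sum>j\<in>S. ip d (a j) (a j)) = (\<Sum>j\<in>S. \<Sum>b\<in>B. (ip d (a j) (u b))\<^sup>2)"
  proof (rule sum.cong[OF refl])
    fix j assume j: "j \<in> S"
    have "ip d (a j) (a j) = ip d (\<lambda>p. \<Sum>b\<in>B. ip d (a j) (u b) * u b p) (a j)"
      by (rule ip_cong) (use span[OF j] in auto)
    also have "\<dots> = (\<Sum>b\<in>B. (ip d (a j) (u b))\<^sup>2)"
      unfolding ip_sum_left by (simp add: power2_eq_square ip_commute[of d "u _"])
    finally show "ip d (a j) (a j) = (\<Sum>b\<in>B. (ip d (a j) (u b))\<^sup>2)" .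
  qed
  also have "\<dots> \<le> (\<Sum>j\<in>J. \<Sum>b\<in>B. (ip d (a j) (u b))\<^sup>2)"
    using J by (intro sum_mono2) (auto intro: sum_nonneg)
  also have "\<dots> = real (card B) * N"
    by (subst sum.swap) (simp add: parseval)
  finally show ?thesis using B by blast
qed

section \<open>Sign vectors with a prescribed column combination, and collision counts\<close>

abbreviation signs :: "'j set \<Rightarrow> ('j \<Rightarrow> real) set" where
  "signs B \<equiv> B \<rightarrow>\<^sub>E {-1, 1}"

text \<open>The default 0 from \<open>d\<close> onwards lets the system of \<open>d\<close>
  equations be stated as equality of functions.\<close>

definition comb :: "nat \<Rightarrow> ('j \<Rightarrow> nat \<Rightarrow> real) \<Rightarrow> 'j set \<Rightarrow> ('j \<Rightarrow> real) \<Rightarrow> nat \<Rightarrow> real" where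
  "comb d a B x = (\<lambda>p. if p < d then \<Sum>j\<in>B. x j * a j p else 0)"

definition sols ::
  "nat \<Rightarrow> ('j \<Rightarrow> nat \<Rightarrow> real) \<Rightarrow> 'j set \<Rightarrow> (nat \<Rightarrow> real) \<Rightarrow> ('j \<Rightarrow> real) set" where
  "sols d a B c = {x \<in> signs B. comb d a B x = c}"

text \<open>The additive energy, equal to the sum of the squared fibre sizes of \<open>f\<close>
  when \<open>X\<close> is finite.\<close>

definition energy :: "'x set \<Rightarrow> ('x \<Rightarrow> 'v) \<Rightarrow> nat" where
  "energy X f = card {(x, y) \<in> X \<times> X. f x = f y}"

lemma finite_signs: "finite B \<Longrightarrow> finite (signs B)"
  by (intro finite_PiE) auto

lemma card_signs: "finite B \<Longrightarrow> card (signs B) = 2 ^ card B"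
  by (simp add: card_PiE numeral_2_eq_2)

lemma finite_sols: "finite B \<Longrightarrow> finite (sols d a B c)"
  unfolding sols_def by (rule finite_subset[OF _ finite_signs]) auto

lemma comb_restrict: "comb d a B (restrict x B) = comb d a B x"
  unfolding comb_def by (auto intro!: sum.cong)

lemma comb_Un:
  "finite B \<Longrightarrow> finite C \<Longrightarrow> B \<inter> C = {} \<Longrightarrow>
     comb d a (B \<union> C) x p = comb d a B x p + comb d a C x p"
  unfolding comb_def by (simp add: sum.union_disjoint)

lemma restrict_eqD: "restrict x B = restrict y B \<Longrightarrow> j \<in> B \<Longrightarrow> x j = y j"
  by (metis restrict_apply')

lemma card_collisions_eq:
  assumes "finite X" "finite Y" "finite T" "f ` X \<subseteq> T"
  shows "card {(x, y) \<in> X \<times> Y. f x = g y}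
       = (\<Sum>t\<in>T. card {x \<in> X. f x = t} * card {y \<in> Y. g y = t})"
proof -
  have "{(x, y) \<in> X \<times> Y. f x = g y} = (\<Union>t\<in>T. {x \<in> X. f x = t} \<times> {y \<in> Y. g y = t})"
    using assms by auto
  also have "card \<dots> = (\<Sum>t\<in>T. card ({x \<in> X. f x = t} \<times> {y \<in> Y. g y = t}))"
    using assms by (intro card_UN_disjoint) auto
  finally show ?thesis by (simp add: card_cartesian_product)
qed

text \<open>Cauchy-Schwarz applied to the fibre sizes of \<open>f\<close> and \<open>g\<close> over
  the common target set \<open>T\<close>.\<close>

lemma card_collisions_le:
  assumes "finite X" "finite Y"
  shows "(card {(x, y) \<in> X \<times> Y. f x = g y})\<^sup>2 \<le> energy X f * energy Y g"
proof -
  define T where "T = f ` X \<union> g ` Y"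
  define m k where "m = (\<lambda>t. card {x \<in> X. f x = t})" and "k = (\<lambda>t. card {y \<in> Y. g y = t})"
  have T: "finite T" "f ` X \<subseteq> T" "g ` Y \<subseteq> T" using assms by (auto simp: T_def)
  have "card {(x, y) \<in> X \<times> Y. f x = g y} = (\<Sum>t\<in>T. m t * k t)"
    unfolding m_def k_def using assms T by (intro card_collisions_eq)
  moreover have "energy X f = (\<Sum>t\<in>T. m t * m t)"
    unfolding energy_def m_def using assms T by (intro card_collisions_eq)
  moreover have "energy Y g = (\<Sum>t\<in>T. k t * k t)"
    unfolding energy_def k_def using assms T by (intro card_collisions_eq)
  moreover have "(\<Sum>t\<in>T. real (m t) * real (k t))\<^sup>2
      \<le> (\<Sum>t\<in>T. (real (m t))\<^sup>2) * (\<Sum>t\<in>T. (real (k t))\<^sup>2)"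
    by (rule Cauchy_Schwarz_ineq_sum)
  then have "real ((\<Sum>t\<in>T. m t * k t)\<^sup>2) \<le> real ((\<Sum>t\<in>T. m t * m t) * (\<Sum>t\<in>T. k t * k t))"
    by (simp add: power2_eq_square)
  ultimately show ?thesis by (simp only: of_nat_le_iff)
qed

text \<open>Once the signs outside \<open>B\<close> are fixed, those on \<open>B\<close> solve a
  system with a shifted right-hand side. This is why \<open>M\<close> must bound the count for every
  \<open>c\<close>.\<close>

lemma card_sols_le_fibre:
  assumes "finite J" "B \<subseteq> J" and M: "\<And>c. card (sols d a B c) \<le> M"
  shows "card (sols d a J c) \<le> 2 ^ card (J - B) * M"
proof -
  let ?c = "\<lambda>y p. c p - comb d a (J - B) y p"
  let ?S = "Sigma (signs (J - B)) (\<lambda>y. sols d a B (?c y))"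
  let ?h = "\<lambda>x. (restrict x (J - B), restrict x B)"
  have fin: "finite B" "finite (J - B)" using assms by (auto intro: finite_subset)
  have disj: "(J - B) \<inter> B = {}" by auto
  have JB: "(J - B) \<union> B = J" using assms by auto
  have "inj_on ?h (sols d a J c)"
  proof (rule inj_onI)
    fix x y assume x: "x \<in> sols d a J c" and y: "y \<in> sols d a J c" and "?h x = ?h y"
    then have "x j = y j" if "j \<in> J" for j
      using that by (cases "j \<in> B") (auto dest: restrict_eqD)
    with x y show "x = y"
      unfolding sols_def by (auto intro: PiE_ext)
  qed
  moreover have "?h ` sols d a J c \<subseteq> ?S"
  proof (rule image_subsetI)
    fix x assume x: "x \<in> sols d a J c"
    then have "comb d a (J - B) x p + comb d a B x p = c p" for p
      using comb_Un[OF fin(2,1) disj, of d a x p, unfolded JB] by (auto simp: sols_def)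
    then have "comb d a B x = ?c x" by (auto simp: algebra_simps)
    with x assms(2) have "restrict x B \<in> sols d a B (?c (restrict x (J - B)))"
      by (auto simp: sols_def comb_restrict restrict_PiE_iff simp del: insert_iff)
    moreover from x have "restrict x (J - B) \<in> signs (J - B)"
      by (auto simp: sols_def restrict_PiE_iff simp del: insert_iff)
    ultimately show "?h x \<in> ?S" by blast
  qed
  moreover have "finite ?S" using fin by (intro finite_SigmaI finite_signs finite_sols)
  ultimately have "card (sols d a J c) \<le> card ?S" by (rule card_inj_on_le)
  also have "\<dots> = (\<Sum>y\<in>signs (J - B). card (sols d a B (?c y)))"
    using fin by (intro card_SigmaI finite_signs ballI finite_sols) 
  also have "\<dots> \<le> card (signs (J - B)) * M"
    using M sum_bounded_above[of "signs (J - B)" "\<lambda>y. card (sols d a B (?c y))" M] by simp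
  also have "card (signs (J - B)) = 2 ^ card (J - B)" using fin by (intro card_signs)
  finally show ?thesis .
qed

lemma indep_comb_eqD:
  assumes "indep d a B" "comb d a B c = (\<lambda>_. 0)" "j \<in> B"
  shows "c j = 0"
proof -
  have "(\<Sum>j\<in>B. c j * a j p) = 0" if "p < d" for p
    using fun_cong[OF assms(2), of p] that by (simp add: comb_def)
  with assms show ?thesis unfolding indep_def by blast
qed

lemma comb_diff: "comb d a B (\<lambda>j. x j - y j) p = comb d a B x p - comb d a B y p"
  by (simp add: comb_def left_diff_distrib sum_subtractf)

text \<open>The difference of two solutions is a vanishing combination of independent
  vectors.\<close>

lemma card_sols_indep:
  assumes "indep d a B" "finite B"
  shows "card (sols d a B c) \<le> 1"
proof -
  have "x = y" if x: "x \<in> sols d a B c" and y: "y \<in> sols d a B c" for x y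
  proof -
    have "comb d a B (\<lambda>j. x j - y j) = (\<lambda>_. 0)"
      using x y by (auto simp: comb_diff sols_def)
    with assms have "x j = y j" if "j \<in> B" for j
      using indep_comb_eqD[OF assms(1) _ that] by fastforce
    with x y show ?thesis unfolding sols_def by (auto intro: PiE_ext)
  qed
  then show ?thesis using finite_sols[OF assms(2)] by (metis card_le_Suc0_iff_eq One_nat_def)
qed

text \<open>The six quadruples are those with \<open>x - x' = y - y'\<close>, a fraction \<open>3/8\<close> of the sixteen
  sign patterns; for two copies instead of four the fraction would only be \<open>1/2\<close>.\<close>

lemma energy_diff_indep:
  assumes "indep d a B" "finite B"
  shows "energy (signs B \<times> signs B) (\<lambda>(x, x') p. comb d a B x p - comb d a B x' p) \<le> 6 ^ card B"
proof -
  let ?E = "{(s, t) \<in> (signs B \<times> signs B) \<times> (signs B \<times> signs B).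
    (case s of (x, x') \<Rightarrow> \<lambda>p. comb d a B x p - comb d a B x' p) =
    (case t of (x, x') \<Rightarrow> \<lambda>p. comb d a B x p - comb d a B x' p)}"
  let ?T = "{(1,1,1,1), (1,1,-1,-1), (-1,-1,1,1), (-1,-1,-1,-1), (1,-1,1,-1), (-1,1,-1,1)}
              :: (real \<times> real \<times> real \<times> real) set"
  let ?h = "\<lambda>((x, x'), (y, y')). \<lambda>j\<in>B. (x j, x' j, y j, y' j)"
  have "inj_on ?h ?E"
  proof (rule inj_onI)
    fix s t assume st: "s \<in> ?E" "t \<in> ?E" and eq: "?h s = ?h t"
    obtain x x' y y' where s: "s = ((x, x'), (y, y'))" by (metis prod.collapse)
    obtain u u' v v' where t: "t = ((u, u'), (v, v'))" by (metis prod.collapse)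
    have *: "x \<in> signs B" "x' \<in> signs B" "y \<in> signs B" "y' \<in> signs B"
      "u \<in> signs B" "u' \<in> signs B" "v \<in> signs B" "v' \<in> signs B"
      using st unfolding s t by simp_all
    have "x j = u j \<and> x' j = u' j \<and> y j = v j \<and> y' j = v' j" if "j \<in> B" for j
      using fun_cong[OF eq, of j] that by (simp add: s t)
    then have "x = u" "x' = u'" "y = v" "y' = v'"
      using PiE_ext[OF *(1,5)] PiE_ext[OF *(2,6)] PiE_ext[OF *(3,7)] PiE_ext[OF *(4,8)] by blast+
    then show "s = t" unfolding s t by simp
  qed
  moreover have "?h ` ?E \<subseteq> B \<rightarrow>\<^sub>E ?T"
  proof (rule image_subsetI)
    fix s assume "s \<in> ?E"
    moreover obtain x x' y y' where s: "s = ((x, x'), (y, y'))" by (metis prod.collapse)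
    ultimately have *: "x \<in> signs B" "x' \<in> signs B" "y \<in> signs B" "y' \<in> signs B"
      and eq: "(\<lambda>p. comb d a B x p - comb d a B x' p) = (\<lambda>p. comb d a B y p - comb d a B y' p)"
      by simp_all
    have "(x j, x' j, y j, y' j) \<in> ?T" if j: "j \<in> B" for j
    proof -
      \<comment> \<open>Independence turns one vector equation into a separate constraint at each
        index.\<close>
      have "comb d a B (\<lambda>j. (x j - x' j) - (y j - y' j)) = (\<lambda>_. 0)"
        using fun_cong[OF eq] by (simp add: fun_eq_iff comb_diff)
      from indep_comb_eqD[OF assms(1) this j] have "x j - x' j = y j - y' j" by simp
      moreover have "x j \<in> {-1, 1}" "x' j \<in> {-1, 1}" "y j \<in> {-1, 1}" "y' j \<in> {-1, 1}"
        using *[THEN PiE_mem, OF j] .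
      ultimately show ?thesis by auto
    qed
    then show "?h s \<in> B \<rightarrow>\<^sub>E ?T"
      unfolding s by (simp add: restrict_PiE_iff del: insert_iff)
  qed
  moreover have "finite (B \<rightarrow>\<^sub>E ?T)" using assms by (intro finite_PiE) auto
  ultimately have "card ?E \<le> card (B \<rightarrow>\<^sub>E ?T)" by (rule card_inj_on_le)
  also have "\<dots> = 6 ^ card B"
  proof -
    have "card ?T = 6" by simp
    then show ?thesis using assms(2) by (simp only: card_PiE prod_constant)
  qed
  finally show ?thesis unfolding energy_def .
qed

text \<open>Moving the \<open>B\<close> terms to one side and the \<open>C\<close> terms to the
  other turns a collision of sums into a collision of differences, so Cauchy-Schwarz reduces to
  \<open>energy_diff_indep\<close> for \<open>B\<close> and for \<open>C\<close>.\<close>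

lemma energy_sum_indep:
  assumes "indep d a B" "finite B" "indep d a C" "finite C"
  shows "(energy (signs B \<times> signs C) (\<lambda>(x, y) p. comb d a B x p + comb d a C y p))\<^sup>2
           \<le> 6 ^ (card B + card C)"
proof -
  let ?D = "\<lambda>A (x, x') p. comb d a A x p - comb d a A x' p"
  let ?E = "{(s, t) \<in> (signs B \<times> signs C) \<times> (signs B \<times> signs C).
    (case s of (x, y) \<Rightarrow> \<lambda>p. comb d a B x p + comb d a C y p) =
    (case t of (x, y) \<Rightarrow> \<lambda>p. comb d a B x p + comb d a C y p)}"
  let ?F = "{(s, t) \<in> (signs B \<times> signs B) \<times> (signs C \<times> signs C). ?D B s = ?D C t}"
  \<comment> \<open>The second pair is reversed because the \<open>C\<close> terms change sign when
    they are rearranged.\<close>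
  let ?h = "\<lambda>((x, y), (x', y')). ((x, x'), (y', y))"
  have "inj_on ?h ?E" by (auto simp: inj_on_def)
  moreover have "?h ` ?E \<subseteq> ?F"
  proof (rule image_subsetI)
    fix s assume "s \<in> ?E"
    moreover obtain x y x' y' where s: "s = ((x, y), (x', y'))" by (metis prod.collapse)
    ultimately have *: "x \<in> signs B" "y \<in> signs C" "x' \<in> signs B" "y' \<in> signs C"
      and eq: "(\<lambda>p. comb d a B x p + comb d a C y p) = (\<lambda>p. comb d a B x' p + comb d a C y' p)"
      by auto
    have "comb d a B x p - comb d a B x' p = comb d a C y' p - comb d a C y p" for p
      using fun_cong[OF eq, of p] by linarith
    with * show "?h s \<in> ?F" unfolding s by simp
  qed
  moreover have "finite ?F"
    by (rule finite_subset[of _ "(signs B \<times> signs B) \<times> (signs C \<times> signs C)"])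
      (use assms in \<open>auto intro!: finite_SigmaI finite_signs simp del: insert_iff PiE_iff\<close>)
  ultimately have "card ?E \<le> card ?F" by (rule card_inj_on_le)
  then have "(card ?E)\<^sup>2 \<le> (card ?F)\<^sup>2" by (rule power_mono) simp
  also have "\<dots> \<le> energy (signs B \<times> signs B) (?D B) * energy (signs C \<times> signs C) (?D C)"
    using assms by (intro card_collisions_le finite_SigmaI finite_signs)
  also have "\<dots> \<le> 6 ^ card B * 6 ^ card C"
    using assms by (intro mult_mono energy_diff_indep) auto
  finally show ?thesis unfolding energy_def by (simp add: power_add)
qed

text \<open>Splitting the four sets into two pairs makes a solution a collision between
  \<open>?f\<close> and \<open>?g'\<close>. One Cauchy-Schwarz separates the pairs, and the one in
  \<open>energy_sum_indep\<close> separates the sets within each pair, whence the fourth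
  power.\<close>

lemma card_sols_four_indep:
  assumes ind: "indep d a B1" "indep d a B2" "indep d a B3" "indep d a B4"
    and fin: "finite B1" "finite B2" "finite B3" "finite B4"
    and dis: "B1 \<inter> B2 = {}" "(B1 \<union> B2) \<inter> B3 = {}" "(B1 \<union> B2 \<union> B3) \<inter> B4 = {}"
  shows "(card (sols d a (B1 \<union> B2 \<union> B3 \<union> B4) c)) ^ 4 \<le> 6 ^ card (B1 \<union> B2 \<union> B3 \<union> B4)"
proof -
  let ?J = "B1 \<union> B2 \<union> B3 \<union> B4"
  let ?f = "\<lambda>(x, y) p. comb d a B1 x p + comb d a B2 y p"
  let ?g = "\<lambda>(x, y) p. comb d a B3 x p + comb d a B4 y p"
  let ?g' = "\<lambda>t p. c p - ?g t p"
  let ?X = "signs B1 \<times> signs B2" and ?Y = "signs B3 \<times> signs B4"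
  let ?F = "{(s, t) \<in> ?X \<times> ?Y. ?f s = ?g' t}"
  let ?h = "\<lambda>x. ((restrict x B1, restrict x B2), (restrict x B3, restrict x B4))"
  have finXY: "finite ?X" "finite ?Y" using fin by (auto intro!: finite_SigmaI finite_signs)
  have "inj_on ?h (sols d a ?J c)"
  proof (rule inj_onI)
    fix x y assume x: "x \<in> sols d a ?J c" and y: "y \<in> sols d a ?J c" and eq: "?h x = ?h y"
    have "restrict x B1 = restrict y B1" "restrict x B2 = restrict y B2"
      "restrict x B3 = restrict y B3" "restrict x B4 = restrict y B4"
      using eq by simp_all
    then have "x j = y j" if "j \<in> ?J" for j
      using that restrict_eqD by (metis UnE)
    with x y show "x = y"
      unfolding sols_def by (auto intro: PiE_ext)
  qed
  moreover have "?h ` sols d a ?J c \<subseteq> ?F"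
  proof (rule image_subsetI)
    fix x assume x: "x \<in> sols d a ?J c"
    have "comb d a ?J x p = comb d a B1 x p + comb d a B2 x p + comb d a B3 x p + comb d a B4 x p" for p
      using fin dis by (simp add: comb_Un)
    with x have "comb d a B1 x p + comb d a B2 x p = c p - (comb d a B3 x p + comb d a B4 x p)" for p
      by (auto simp: sols_def)
    then have "?f (restrict x B1, restrict x B2) = ?g' (restrict x B3, restrict x B4)"
      by (simp add: comb_restrict)
    moreover have "restrict x A \<in> signs A" if "A \<subseteq> ?J" for A
      using x that unfolding sols_def by (auto simp: restrict_PiE_iff simp del: insert_iff)
    ultimately show "?h x \<in> ?F" by blast
  qed
  moreover have "finite ?F"
    by (rule finite_subset[of _ "?X \<times> ?Y"]) (use finXY in auto)
  ultimately have "card (sols d a ?J c) \<le> card ?F" by (rule card_inj_on_le)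
  then have "(card (sols d a ?J c))\<^sup>2 \<le> (card ?F)\<^sup>2" by (rule power_mono) simp
  also have "\<dots> \<le> energy ?X ?f * energy ?Y ?g'"
    by (rule card_collisions_le) (use finXY in auto)
  \<comment> \<open>Replacing \<open>?g\<close> by \<open>c - ?g\<close> keeps all coincidences, so
    the bound is uniform in \<open>c\<close>.\<close>
  also have "energy ?Y ?g' = energy ?Y ?g"
    unfolding energy_def by (simp add: fun_eq_iff)
  finally have "((card (sols d a ?J c))\<^sup>2)\<^sup>2 \<le> (energy ?X ?f * energy ?Y ?g)\<^sup>2"
    by (rule power_mono) simp
  also have "\<dots> = (energy ?X ?f)\<^sup>2 * (energy ?Y ?g)\<^sup>2" by (rule power_mult_distrib)
  also have "\<dots> \<le> 6 ^ (card B1 + card B2) * 6 ^ (card B3 + card B4)"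
    using ind fin by (intro mult_mono energy_sum_indep) auto
  also have "\<dots> = 6 ^ card ?J"
    using fin dis by (simp add: card_Un_disjoint power_add)
  finally show ?thesis by (simp flip: power_mult)
qed

section \<open>Counting the possible next rows of a partial Hadamard matrix\<close>

definition partial_hadamard :: "nat \<Rightarrow> nat \<Rightarrow> (nat \<Rightarrow> nat \<Rightarrow> real) set" where
  "partial_hadamard n k = {f \<in> {..<k} \<rightarrow>\<^sub>E signs {..<n}.
     \<forall>p<k. \<forall>q<k. p \<noteq> q \<longrightarrow> (\<Sum>j<n. f p j * f q j) = 0}"

text \<open>Orthogonality to the \<open>k\<close> rows is read as a vanishing combination of the
  columns, which makes it an instance of \<open>sols\<close>.\<close>

definition extensions :: "nat \<Rightarrow> nat \<Rightarrow> (nat \<Rightarrow> nat \<Rightarrow> real) \<Rightarrow> (nat \<Rightarrow> real) set" where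
  "extensions n k f = sols k (\<lambda>j p. f p j) {..<n} (\<lambda>_. 0)"

lemma finite_partial_hadamard: "finite (partial_hadamard n k)"
  unfolding partial_hadamard_def
  by (rule finite_subset[of _ "{..<k} \<rightarrow>\<^sub>E signs {..<n}"]) (auto intro!: finite_PiE finite_signs)

lemma sign_square:
  assumes "x \<in> signs B" "j \<in> B"
  shows "x j * x j = 1"
  using PiE_mem[OF assms] by auto

text \<open>Columns have squared norm \<open>k\<close> and rows squared norm \<open>n\<close>, so
  \<open>exists_large_indep\<close> gives rank at least \<open>k * card S / n\<close>. For positive
  \<open>n\<close>, hypothesis \<open>m\<close> says that \<open>m\<close> is at most this quotient
  rounded up.\<close>

lemma partial_hadamard_indep_columns:
  assumes f: "f \<in> partial_hadamard n k" and S: "S \<subseteq> {..<n}" and m: "m * n < k * card S + n"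
  shows "\<exists>B\<subseteq>S. indep k (\<lambda>j p. f p j) B \<and> card B = m"
proof -
  have row: "f p \<in> signs {..<n}" if "p < k" for p
    using f that unfolding partial_hadamard_def by (blast intro: PiE_mem)
  have orth: "(\<Sum>j<n. f p j * f q j) = (if p = q then real n else 0)" if "p < k" "q < k" for p q
  proof (cases "p = q")
    case True
    have "(\<Sum>j<n. f q j * f q j) = (\<Sum>j<n. 1)"
      by (rule sum.cong[OF refl]) (use sign_square[OF row[OF that(2)]] in auto)
    then show ?thesis using True by simp
  next
    case False
    then show ?thesis using f that unfolding partial_hadamard_def by simp
  qed
  obtain B where B: "B \<subseteq> S" "indep k (\<lambda>j p. f p j) B"
    and le: "(\<Sum>j\<in>S. ip k (\<lambda>p. f p j) (\<lambda>p. f p j)) \<le> real (card B) * real n"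
    using exists_large_indep[OF finite_lessThan S, of k "\<lambda>j p. f p j" "real n"] orth by auto
  have "ip k (\<lambda>p. f p j) (\<lambda>p. f p j) = real k" if "j \<in> S" for j
  proof -
    have "ip k (\<lambda>p. f p j) (\<lambda>p. f p j) = (\<Sum>p<k. 1)"
      unfolding ip_def using sign_square[OF row] that S by (intro sum.cong) auto
    then show ?thesis by simp
  qed
  with le have "real (card S) * real k \<le> real (card B) * real n" by simp
  then have "k * card S \<le> card B * n"
    by (simp only: of_nat_mult[symmetric] of_nat_le_iff mult.commute)
  with m have "m * n < (card B + 1) * n" by simp
  then have "m \<le> card B" by (simp only: mult_less_cancel2) linarith
  then obtain C where "C \<subseteq> B" "card C = m" by (metis obtain_subset_with_card_n)
  moreover have "finite B" using B S by (meson finite_lessThan finite_subset)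
  ultimately show ?thesis
    using B indep_subset by (metis subset_trans)
qed

text \<open>Among all columns there are \<open>k\<close> independent ones, and the other
  \<open>n - k\<close> signs determine the signs there.\<close>

lemma odlyzko_bound:
  assumes "f \<in> partial_hadamard n k" "n > 0"
  shows "k \<le> n" "card (extensions n k f) \<le> 2 ^ (n - k)"
proof -
  obtain B where B: "B \<subseteq> {..<n}" "indep k (\<lambda>j p. f p j) B" "card B = k"
    using partial_hadamard_indep_columns[OF assms(1) order_refl, of k] assms(2) by auto
  have fin: "finite B" using B by (meson finite_lessThan finite_subset)
  show "k \<le> n" using card_mono[OF _ B(1)] B(3) by simp
  have "card (extensions n k f) \<le> 2 ^ card ({..<n} - B) * 1"
    unfolding extensions_def using B fin by (intro card_sols_le_fibre card_sols_indep) auto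
  then show "card (extensions n k f) \<le> 2 ^ (n - k)"
    using B fin by (simp add: card_Diff_subset)
qed

text \<open>The sets are chosen greedily. Those already chosen cover at most \<open>3 * m\<close>
  columns, which is at most \<open>n / 4\<close>, so the remaining columns have rank at least
  \<open>3 * k / 4\<close>; the slack 3 in the bound on \<open>m\<close> permits rounding
  up.\<close>

lemma card_extensions_four_bases:
  assumes f: "f \<in> partial_hadamard n k" and n: "n > 0" "12 * k \<le> n"
    and m: "m \<le> k" "4 * m \<le> 3 * k + 3"
  shows "card (extensions n k f) \<le> 2 ^ (n - 4 * m) * 6 ^ m"
proof -
  let ?a = "\<lambda>j p. f p j"
  have ex: "\<exists>B\<subseteq>{..<n} - A. indep k ?a B \<and> card B = m"
    if A: "A \<subseteq> {..<n}" "card A \<le> 3 * m" for A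
  proof (rule partial_hadamard_indep_columns[OF f])
    have "finite A" using A by (meson finite_lessThan finite_subset)
    then have "card ({..<n} - A) = n - card A" using A by (simp add: card_Diff_subset)
    then have "n \<le> card ({..<n} - A) + 3 * m" using A by simp
    then have "k * n \<le> k * (card ({..<n} - A) + 3 * m)" by (rule mult_le_mono2)
    then have 1: "k * n \<le> k * card ({..<n} - A) + 3 * (k * m)" by (simp add: algebra_simps)
    have "12 * k * m \<le> n * k" using n m by (intro mult_le_mono) auto
    then have 2: "12 * (k * m) \<le> k * n" by (simp add: algebra_simps)
    have "4 * m * n \<le> (3 * k + 3) * n" using m by (intro mult_le_mono1)
    then have "4 * (m * n) \<le> 3 * (k * n) + 3 * n" by (simp add: algebra_simps)
    with 1 2 n(1) show "m * n < k * card ({..<n} - A) + n" by linarith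
  qed auto
  obtain B1 where B1: "B1 \<subseteq> {..<n}" "indep k ?a B1" "card B1 = m"
    using ex[of "{}"] by auto
  obtain B2 where B2: "B2 \<subseteq> {..<n} - B1" "indep k ?a B2" "card B2 = m"
    using ex[of B1] B1 by auto
  have fin12: "finite B1" "finite B2" using B1 B2 by (auto intro: finite_subset)
  have dis12: "B1 \<inter> B2 = {}" using B2 by auto
  have c12: "card (B1 \<union> B2) = 2 * m"
    using B1 B2 fin12 dis12 by (simp add: card_Un_disjoint)
  obtain B3 where B3: "B3 \<subseteq> {..<n} - (B1 \<union> B2)" "indep k ?a B3" "card B3 = m"
    using ex[of "B1 \<union> B2"] B1 B2 c12 by auto
  have fin3: "finite B3" using B3 by (auto intro: finite_subset)
  have dis3: "(B1 \<union> B2) \<inter> B3 = {}" using B3 by auto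
  have c123: "card (B1 \<union> B2 \<union> B3) = 3 * m"
    using c12 B3 fin12 fin3 dis3 by (simp add: card_Un_disjoint)
  obtain B4 where B4: "B4 \<subseteq> {..<n} - (B1 \<union> B2 \<union> B3)" "indep k ?a B4" "card B4 = m"
    using ex[of "B1 \<union> B2 \<union> B3"] B1 B2 B3 c123 by auto
  have fin4: "finite B4" using B4 by (auto intro: finite_subset)
  have dis4: "(B1 \<union> B2 \<union> B3) \<inter> B4 = {}" using B4 by auto
  define J where "J = B1 \<union> B2 \<union> B3 \<union> B4"
  have cJ: "card J = 4 * m"
    unfolding J_def using c123 B4 fin12 fin3 fin4 dis4 by (simp add: card_Un_disjoint)
  have J: "J \<subseteq> {..<n}" using B1 B2 B3 B4 by (auto simp: J_def)
  have "card (sols k ?a J c) \<le> 6 ^ m" for c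
  \<comment> \<open>The rule compares powers with exponent \<open>Suc 3\<close>, that is, fourth
    powers.\<close>
  proof (rule power_le_imp_le_base[of _ 3])
    have "card (sols k ?a J c) ^ 4 \<le> 6 ^ card J"
      unfolding J_def using B1 B2 B3 B4 fin12 fin3 fin4 dis12 dis3 dis4
      by (intro card_sols_four_indep) auto
    also have "\<dots> = (6 ^ m) ^ 4" unfolding cJ by (simp add: power_mult[symmetric] mult.commute)
    finally show "card (sols k ?a J c) ^ Suc 3 \<le> (6 ^ m) ^ Suc 3" by simp
  qed simp
  then have "card (extensions n k f) \<le> 2 ^ card ({..<n} - J) * 6 ^ m"
    unfolding extensions_def using J by (intro card_sols_le_fibre) auto
  also have "card ({..<n} - J) = n - 4 * m"
    using J cJ finite_subset[OF J] by (simp add: card_Diff_subset)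
  finally show ?thesis .
qed

section \<open>Explicit exponents and their sum\<close>

definition extension_exponent :: "nat \<Rightarrow> nat \<Rightarrow> real" where
  "extension_exponent n k = real n - real k - (if 12 * k \<le> n then real k / 20 else 0)"

text \<open>This is 243 < 256, since \<open>(3/8)^5 = 243 / 2^15\<close>. The exponent 7/5 exceeds
  4/3, so using about \<open>3 * k / 4\<close> columns per set saves more than \<open>k\<close>
  bits.\<close>

lemma three_eighths_le: "(3 / 8 :: real) \<le> 2 powr (- 7 / 5)"
proof -
  have "(3 / 8 :: real) = ((3 / 8) ^ 5) powr (1 / 5)"
    by (simp add: powr_powr flip: powr_numeral)
  also have "\<dots> \<le> (2 powr (- 7)) powr (1 / 5)"
    by (rule powr_mono2) (simp_all add: powr_minus divide_simps)
  finally show ?thesis by (simp add: powr_powr)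
qed

lemma card_extensions_le:
  assumes f: "f \<in> partial_hadamard n k" and n: "n > 0"
  shows "real (card (extensions n k f)) \<le> 2 powr extension_exponent n k"
proof (cases "12 * k \<le> n")
  case False
  have "real (card (extensions n k f)) \<le> real (2 ^ (n - k))"
    using odlyzko_bound[OF f n] by (simp only: of_nat_le_iff)
  also have "\<dots> = 2 powr (real n - real k)"
    using odlyzko_bound(1)[OF f n] by (simp add: powr_realpow[symmetric] of_nat_diff)
  finally show ?thesis using False by (simp add: extension_exponent_def)
next
  case True
  \<comment> \<open>This is \<open>3 * k / 4\<close> rounded up.\<close>
  define m where "m = (3 * k + 3) div 4"
  have m: "m \<le> k" "4 * m \<le> 3 * k + 3" "3 * k \<le> 4 * m" unfolding m_def by linarith+
  have "4 * m \<le> n" using m True by linarith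
  have "real (card (extensions n k f)) \<le> real (2 ^ (n - 4 * m) * 6 ^ m)"
    using card_extensions_four_bases[OF f n True m(1,2)] by (simp only: of_nat_le_iff)
  also have "\<dots> = 2 ^ n * (3 / 8) ^ m"
  proof -
    have "(2::real) ^ n * (3 / 8) ^ m = 2 ^ (n - 4 * m) * (2 ^ (4 * m) * (3 / 8) ^ m)"
      using \<open>4 * m \<le> n\<close> by (simp flip: power_add mult.assoc)
    also have "(2::real) ^ (4 * m) * (3 / 8) ^ m = 6 ^ m"
      by (simp add: power_mult flip: power_mult_distrib)
    finally show ?thesis by simp
  qed
  also have "\<dots> \<le> 2 ^ n * (2 powr (- 7 / 5)) ^ m"
    using three_eighths_le by (intro mult_left_mono power_mono) auto
  also have "\<dots> = 2 powr (real n - 7 / 5 * real m)"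
  proof -
    have "(2 powr (- 7 / 5)) ^ m = 2 powr (- (7 / 5) * real m)"
      by (simp add: powr_realpow[symmetric] powr_powr)
    moreover have "(2::real) ^ n = 2 powr real n" by (simp add: powr_realpow)
    ultimately show ?thesis by (simp flip: powr_add)
  qed
  \<comment> \<open>From \<open>3 * k \<le> 4 * m\<close> the saving is at least
    \<open>7/5 * 3/4 * k = k + k / 20\<close>.\<close>
  also have "\<dots> \<le> 2 powr extension_exponent n k"
    using m(3) True by (intro powr_mono) (auto simp: extension_exponent_def)
  finally show ?thesis .
qed

text \<open>Splitting off the last row embeds these matrices into pairs of a \<open>k\<close>-row
  matrix and one of its extensions.\<close>

lemma card_partial_hadamard_Suc:
  assumes n: "n > 0"
  shows "real (card (partial_hadamard n (Suc k)))
           \<le> real (card (partial_hadamard n k)) * 2 powr extension_exponent n k"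
proof -
  let ?S = "Sigma (partial_hadamard n k) (extensions n k)"
  let ?h = "\<lambda>f. (restrict f {..<k}, f k)"
  have "inj_on ?h (partial_hadamard n (Suc k))"
  proof (rule inj_onI)
    fix f g assume f: "f \<in> partial_hadamard n (Suc k)" and g: "g \<in> partial_hadamard n (Suc k)"
      and eq: "?h f = ?h g"
    have "f p = g p" if "p < Suc k" for p
      using eq that restrict_eqD[of f "{..<k}" g p] by (cases "p = k") auto
    moreover have "f \<in> {..<Suc k} \<rightarrow>\<^sub>E signs {..<n}" "g \<in> {..<Suc k} \<rightarrow>\<^sub>E signs {..<n}"
      using f g unfolding partial_hadamard_def by blast+
    ultimately show "f = g" by (meson PiE_ext lessThan_iff)
  qed
  moreover have "?h ` partial_hadamard n (Suc k) \<subseteq> ?S"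
  proof (rule image_subsetI)
    fix f assume f: "f \<in> partial_hadamard n (Suc k)"
    then have row: "f p \<in> signs {..<n}" if "p < Suc k" for p
      unfolding partial_hadamard_def using that by (blast intro: PiE_mem)
    have orth: "(\<Sum>j<n. f p j * f q j) = 0" if "p < Suc k" "q < Suc k" "p \<noteq> q" for p q
      using f that unfolding partial_hadamard_def by blast
    have "restrict f {..<k} \<in> partial_hadamard n k"
      unfolding partial_hadamard_def using row orth
      by (auto simp: restrict_PiE_iff simp del: PiE_iff insert_iff)
    moreover have "f k \<in> extensions n k (restrict f {..<k})"
      unfolding extensions_def sols_def comb_def using row orth
      by (auto simp: fun_eq_iff simp del: PiE_iff insert_iff)
    ultimately show "?h f \<in> ?S" by blast
  qed
  moreover have fin: "finite (extensions n k f)" for f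
    unfolding extensions_def by (intro finite_sols) simp
  then have "finite ?S" by (intro finite_SigmaI finite_partial_hadamard)
  ultimately have "card (partial_hadamard n (Suc k)) \<le> card ?S" by (rule card_inj_on_le)
  also have "\<dots> = (\<Sum>f\<in>partial_hadamard n k. card (extensions n k f))"
    using fin by (intro card_SigmaI finite_partial_hadamard) auto
  finally have "real (card (partial_hadamard n (Suc k)))
      \<le> (\<Sum>f\<in>partial_hadamard n k. real (card (extensions n k f)))"
    by (simp only: of_nat_le_iff flip: of_nat_sum)
  also have "\<dots> \<le> real (card (partial_hadamard n k)) * 2 powr extension_exponent n k"
    by (rule sum_bounded_above) (rule card_extensions_le[OF _ n])
  finally show ?thesis .
qed

lemma card_partial_hadamard_le:
  assumes "n > 0"
  shows "real (card (partial_hadamard n k)) \<le> 2 powr (\<Sum>i<k. extension_exponent n i)"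
proof (induction k)
  case 0
  have "partial_hadamard n 0 = {\<lambda>_. undefined}" unfolding partial_hadamard_def by auto
  then show ?case by simp
next
  case (Suc k)
  note card_partial_hadamard_Suc[OF assms, of k]
  also have "real (card (partial_hadamard n k)) * 2 powr extension_exponent n k
      \<le> 2 powr (\<Sum>i<k. extension_exponent n i) * 2 powr extension_exponent n k"
    by (rule mult_right_mono[OF Suc]) simp
  finally show ?case by (simp add: powr_add)
qed

text \<open>Without the saving the sum is \<open>n * (n + 1) / 2\<close>. The saving is about
  \<open>(n / 12)^2 / 40 = n^2 / 5760\<close>; half of it gives the constant, and the other half
  absorbs the linear terms.\<close>

lemma sum_extension_exponent_le:
  assumes "n \<ge> 10000"
  shows "(\<Sum>i<n. extension_exponent n i) \<le> (1 - 1 / 5760) * (real n)\<^sup>2 / 2"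
proof -
  have gauss: "(\<Sum>i<k. real i) = real k * (real k - 1) / 2" for k
    by (induction k) (auto simp: field_simps)
  define m where "m = n div 12"
  \<comment> \<open>All indices up to and including \<open>m = n div 12\<close> meet the cutoff,
    hence \<open>Suc m\<close> terms.\<close>
  have "(\<Sum>i<Suc m. real i) = (\<Sum>i<Suc m. if 12 * i \<le> n then real i else 0)"
    by (rule sum.cong) (auto simp: m_def)
  also have "\<dots> \<le> (\<Sum>i<n. if 12 * i \<le> n then real i else 0)"
    using assms by (intro sum_mono2) (auto simp: m_def)
  finally have saving: "real (Suc m) * (real (Suc m) - 1) / 2
      \<le> (\<Sum>i<n. if 12 * i \<le> n then real i else 0)"
    unfolding gauss .
  have "n < 12 * Suc m" unfolding m_def by presburger
  then have "real n \<le> real (12 * Suc m)" by (simp only: of_nat_le_iff)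
  then have nm: "real n / 12 \<le> real (Suc m)" by simp
  have "(real n / 12) * (real n / 12 - 1) \<le> real (Suc m) * (real (Suc m) - 1)"
    using nm assms by (intro mult_mono) auto
  then have "(real n / 12) * (real n / 12 - 1) / 2 \<le> real (Suc m) * (real (Suc m) - 1) / 2"
    by (rule divide_right_mono) simp
  from order_trans[OF this saving] have saving': "(real n / 12) * (real n / 12 - 1) / 2
      \<le> (\<Sum>i<n. if 12 * i \<le> n then real i else 0)" .
  have "(\<Sum>i<n. extension_exponent n i)
      = (\<Sum>i<n. real n - real i - (if 12 * i \<le> n then real i else 0) / 20)"
    by (rule sum.cong) (auto simp: extension_exponent_def)
  also have "\<dots> = real n * real n - real n * (real n - 1) / 2
      - (\<Sum>i<n. if 12 * i \<le> n then real i else 0) / 20"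
    by (simp only: sum_subtractf gauss flip: sum_divide_distrib) simp
  also have "\<dots> \<le> real n * real n - real n * (real n - 1) / 2
      - (real n / 12) * (real n / 12 - 1) / 2 / 20"
    using saving' by (intro diff_left_mono divide_right_mono) auto
  also have "\<dots> \<le> (1 - 1 / 5760) * (real n)\<^sup>2 / 2"
  proof -
    \<comment> \<open>The linear terms total \<open>241/480 * n\<close>, which
      \<open>n^2 / 11520\<close> dominates once \<open>n\<close> is at least 5784.\<close>
    have "10000 * real n \<le> real n * real n" using assms by (intro mult_right_mono) auto
    then show ?thesis by (simp add: power2_eq_square field_simps)
  qed
  finally show ?thesis .
qed

text \<open>Matrices embed through their entry functions; the off-diagonal entries of the product
  with the transpose are the row inner products.\<close>

lemma hadamard_count_le: "hadamard_count n \<le> card (partial_hadamard n n)"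
  unfolding hadamard_count_def
proof (rule card_inj_on_le)
  let ?h = "\<lambda>H. \<lambda>p\<in>{..<n}. \<lambda>j\<in>{..<n}. (H :: real mat) $$ (p, j)"
  show "inj_on ?h (hadamard_matrices n)"
  proof (rule inj_onI)
    fix G H assume "G \<in> hadamard_matrices n" "H \<in> hadamard_matrices n" and eq: "?h G = ?h H"
    then have dim: "G \<in> carrier_mat n n" "H \<in> carrier_mat n n"
      by (auto simp: hadamard_matrices_def)
    have "G $$ (p, j) = H $$ (p, j)" if "p < n" "j < n" for p j
      using fun_cong[OF fun_cong[OF eq, of p], of j] that by simp
    with dim show "G = H" by (intro eq_matI) auto
  qed
  show "?h ` hadamard_matrices n \<subseteq> partial_hadamard n n"
  proof (rule image_subsetI)
    fix H assume "H \<in> hadamard_matrices n"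
    then have dim: "H \<in> carrier_mat n n" and el: "elements_mat H \<subseteq> {-1, 1}"
      and orth: "H * transpose_mat H = real n \<cdot>\<^sub>m 1\<^sub>m n"
      by (auto simp: hadamard_matrices_def)
    have "H $$ (p, j) \<in> {-1, 1}" if "p < n" "j < n" for p j
      using elements_matI[OF dim that refl] el by blast
    moreover have "(\<Sum>j<n. H $$ (p, j) * H $$ (q, j)) = 0" if "p < n" "q < n" "p \<noteq> q" for p q
    proof -
      have "(\<Sum>j<n. H $$ (p, j) * H $$ (q, j)) = (H * transpose_mat H) $$ (p, q)"
        using dim that by (simp add: scalar_prod_def atLeast0LessThan)
      also have "\<dots> = 0" unfolding orth using that by simp
      finally show ?thesis .
    qed
    ultimately show "?h H \<in> partial_hadamard n n"
      unfolding partial_hadamard_def by (simp add: restrict_PiE_iff del: insert_iff)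
  qed
qed (rule finite_partial_hadamard)

theorem theorem1p2:
  shows "\<exists>c_H::real. c_H > 0 \<and>
    (\<exists>N::nat. \<forall>n\<ge>N. 4 dvd n \<longrightarrow>
       real (hadamard_count n) \<le> 2 powr ((1 - c_H) * (real n)^2 / 2))"
proof (intro exI conjI allI impI)
  show "(1 / 5760 :: real) > 0" by simp
  fix n :: nat assume n: "n \<ge> 10000"
  have "real (hadamard_count n) \<le> real (card (partial_hadamard n n))"
    using hadamard_count_le by (simp only: of_nat_le_iff)
  also have "\<dots> \<le> 2 powr (\<Sum>i<n. extension_exponent n i)"
    using n by (intro card_partial_hadamard_le) simp
  also have "\<dots> \<le> 2 powr ((1 - 1 / 5760) * (real n)^2 / 2)"
    using sum_extension_exponent_le[OF n] by (intro powr_mono) auto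
  finally show "real (hadamard_count n) \<le> 2 powr ((1 - 1 / 5760) * (real n)^2 / 2)" .
qed

end
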